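(* Let $n \geq 1$ and let $G$ be the sibling tree $ST_n$. Then the locating-domination number of $G$ is $$\gamma^{L}(G) = \begin{cases} \frac{1}{5}(2^{n+2}+1) & \text{if } n\equiv 0 \pmod 4,\\ \frac{1}{5}(2^{n+2}+2) & \text{if } n\equiv 1 \pmod 4,\\ \frac{1}{5}(2^{n+2}-1) & \text{if } n\equiv 2 \pmod 4,\\ \frac{1}{5}(2^{n+2}-2) & \text{if } n\equiv 3 \pmod 4.\end{cases}$$
   Context: The sibling tree $ST_n$ has vertex set $\{1,2,\dots,2^{n+1}-1\}$; its edges are the edges of the complete binary tree of height $n$ in which vertex $x$ has children $2x$ and $2x+1$ (root $1$ at level $0$; vertex $v$ is at level $i$ iff $2^i\le v\le 2^{i+1}-1$), together with the sibling edges $\{2x,2x+1\}$ for every $x$ with $1\le x\le 2^n-1$. A locating-dominating set of $G$ is a set $S\subseteq V(G)$ such that every vertex of $V(G)\setminus S$ is adjacent to some vertex of $S$, and for every two distinct vertices $u,v\in V(G)\setminus S$, $N(u)\cap S\neq N(v)\cap S$ (open neighborhoods). $\gamma^{L}(G)$ is the minimum cardinality of a locating-dominating set. *)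

theory Defs
  imports Complex_Main
begin

text \<open>
  A finite simple graph is given by its vertex set \<open>V\<close> and its edge set \<open>E\<close>,
  the edges being two-element subsets of \<open>V\<close>.
\<close>

definition neighborhood :: "'a set \<Rightarrow> 'a set set \<Rightarrow> 'a \<Rightarrow> 'a set" where
  "neighborhood V E v = {u \<in> V. {u, v} \<in> E}"

definition locating_dominating :: "'a set \<Rightarrow> 'a set set \<Rightarrow> 'a set \<Rightarrow> bool" where
  "locating_dominating V E S \<longleftrightarrow>
     S \<subseteq> V \<and>
     (\<forall>v \<in> V - S. \<exists>u \<in> S. {u, v} \<in> E) \<and>
     (\<forall>u \<in> V - S. \<forall>v \<in> V - S. u \<noteq> v \<longrightarrow>
        neighborhood V E u \<inter> S \<noteq> neighborhood V E v \<inter> S)"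

definition locating_domination_number :: "'a set \<Rightarrow> 'a set set \<Rightarrow> nat" where
  "locating_domination_number V E = (LEAST k. \<exists>S. locating_dominating V E S \<and> card S = k)"

definition ST_verts :: "nat \<Rightarrow> nat set" where
  "ST_verts n = {1..2 ^ (n + 1) - 1}"

definition ST_edges :: "nat \<Rightarrow> nat set set" where
  "ST_edges n =
     {{x, 2 * x} | x. 1 \<le> x \<and> x \<le> 2 ^ n - 1} \<union>
     {{x, 2 * x + 1} | x. 1 \<le> x \<and> x \<le> 2 ^ n - 1} \<union>
     {{2 * x, 2 * x + 1} | x. 1 \<le> x \<and> x \<le> 2 ^ n - 1}"

end

theory Submission
  imports Defs
begin

text \<open>
  Removing the last four levels of a sibling tree, so that the vertices \<open>{1..<N}\<close> remain, lowers the
  locating-domination number by exactly \<open>6 * N\<close>; together with the trees of at most three levels this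
  determines all values.

  Upper bound: a locating-dominating set of the small tree extends by the second new level and by one
  vertex of every sibling pair on the last one. Two vertices with two common neighbors coincide, so
  only vertices with a single neighbor in the set need to be compared.

  Lower bound: each of the \<open>2 * N\<close> subtrees formed by the last three levels contains at least three
  members of the set. Moving its members on the first new level to their parents gives a
  locating-dominating set of the small tree, because supersets of locating-dominating sets are
  locating-dominating.
\<close>

section \<open>Locating-dominating sets\<close>

lemma neighborhood_Int_subset: "S \<subseteq> T \<Longrightarrow> neighborhood T E v \<inter> S = neighborhood S E v"
  by (auto simp: neighborhood_def)

lemma locating_dominating_iff:
  "locating_dominating V E S \<longleftrightarrow>
     S \<subseteq> V \<and> (\<forall>v \<in> V - S. neighborhood S E v \<noteq> {}) \<and> inj_on (neighborhood S E) (V - S)"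
proof (cases "S \<subseteq> V")
  case True
  have "(\<exists>u \<in> S. {u, v} \<in> E) \<longleftrightarrow> neighborhood S E v \<noteq> {}" for v
    by (auto simp: neighborhood_def)
  with True show ?thesis
    by (auto simp: locating_dominating_def inj_on_def neighborhood_Int_subset)
qed (simp add: locating_dominating_def)

lemma locating_dominating_subset: "locating_dominating V E S \<Longrightarrow> S \<subseteq> V"
  by (simp add: locating_dominating_def)

lemma locating_dominating_self: "locating_dominating V E V"
  by (simp add: locating_dominating_def)

lemma locating_dominating_superset:
  assumes "locating_dominating V E S" "S \<subseteq> T" "T \<subseteq> V"
  shows "locating_dominating V E T"
proof -
  have "inj_on (neighborhood S E) (V - T)"
    using assms by (auto simp: locating_dominating_iff intro: inj_on_subset)
  then have "inj_on (neighborhood T E) (V - T)"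
    unfolding inj_on_def neighborhood_Int_subset[OF assms(2), symmetric] by simp
  then show ?thesis
    using assms
    by (auto simp: locating_dominating_iff simp flip: neighborhood_Int_subset[OF assms(2)])
qed

lemma locating_dominating_restrict:
  assumes "locating_dominating V E S" "W \<subseteq> V"
    and no_edge: "\<And>u v. \<lbrakk>u \<in> S - W; v \<in> W - S\<rbrakk> \<Longrightarrow> {u, v} \<notin> E"
  shows "locating_dominating W E (S \<inter> W)"
proof -
  have "neighborhood (S \<inter> W) E v = neighborhood S E v" if "v \<in> W - S" for v
    using no_edge that by (auto simp: neighborhood_def)
  moreover have "\<forall>v \<in> W - S. neighborhood S E v \<noteq> {}" "inj_on (neighborhood S E) (W - S)"
    using assms(1,2) by (auto simp: locating_dominating_iff intro: inj_on_subset)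
  ultimately have "\<forall>v \<in> W - S. neighborhood (S \<inter> W) E v \<noteq> {}"
    "inj_on (neighborhood (S \<inter> W) E) (W - S)"
    by (auto simp: inj_on_def)
  moreover have "W - S \<inter> W = W - S" by blast
  ultimately show ?thesis by (simp add: locating_dominating_iff)
qed

lemma locating_dominating_cong:
  assumes "\<And>u v. \<lbrakk>u \<in> V; v \<in> V\<rbrakk> \<Longrightarrow> {u, v} \<in> E \<longleftrightarrow> {u, v} \<in> F"
  shows "locating_dominating V E S \<longleftrightarrow> locating_dominating V F S"
proof (cases "S \<subseteq> V")
  case True
  with assms have "neighborhood S E v = neighborhood S F v" if "v \<in> V" for v
    using that by (auto simp: neighborhood_def)
  then show ?thesis by (simp add: locating_dominating_iff inj_on_def)
qed (simp add: locating_dominating_iff)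

lemma card_Diff_locating_dominating:
  assumes "locating_dominating V E S" "finite S"
  shows "card (V - S) < 2 ^ card S"
proof -
  have "card (V - S) = card (neighborhood S E ` (V - S))"
    using assms(1) by (simp add: locating_dominating_iff card_image)
  also have "\<dots> < card (Pow S)"
  proof (rule psubset_card_mono)
    have "neighborhood S E ` (V - S) \<subseteq> Pow S - {{}}"
      using assms(1) by (auto simp: locating_dominating_iff neighborhood_def)
    then show "neighborhood S E ` (V - S) \<subset> Pow S" by auto
  qed (use assms(2) in simp)
  finally show ?thesis using assms(2) by (simp add: card_Pow)
qed

lemma locating_domination_number_le:
  "locating_dominating V E S \<Longrightarrow> locating_domination_number V E \<le> card S"
  unfolding locating_domination_number_def by (rule Least_le) blast

lemma locating_domination_number_attained:
  obtains S where "locating_dominating V E S" "card S = locating_domination_number V E"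
proof -
  have "\<exists>S. locating_dominating V E S \<and> card S = locating_domination_number V E"
    unfolding locating_domination_number_def
    by (rule LeastI_ex) (use locating_dominating_self in blast)
  then show thesis using that by blast
qed

section \<open>The infinite sibling tree\<close>

definition sibling_edges :: "nat set set" where
  "sibling_edges = (\<Union>x \<in> {1..}. {{x, 2 * x}, {x, 2 * x + 1}, {2 * x, 2 * x + 1}})"

abbreviation sibling_code :: "nat set \<Rightarrow> nat \<Rightarrow> nat set" where
  "sibling_code S \<equiv> neighborhood S sibling_edges"

abbreviation sibling_ld :: "nat \<Rightarrow> nat set \<Rightarrow> bool" where
  "sibling_ld N \<equiv> locating_dominating {1..<N} sibling_edges"

abbreviation sibling_ldn :: "nat \<Rightarrow> nat" where
  "sibling_ldn N \<equiv> locating_domination_number {1..<N} sibling_edges"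

lemma ST_verts_eq: "ST_verts n = {1..<2 ^ (n + 1)}"
  by (auto simp: ST_verts_def)

lemma ST_edges_eq: "ST_edges n = {e \<in> sibling_edges. e \<subseteq> ST_verts n}"
  unfolding ST_edges_def sibling_edges_def ST_verts_def by fastforce

lemma locating_domination_number_ST:
  "locating_domination_number (ST_verts n) (ST_edges n) = sibling_ldn (2 ^ (n + 1))"
proof -
  have "locating_dominating (ST_verts n) (ST_edges n) S \<longleftrightarrow>
      locating_dominating (ST_verts n) sibling_edges S" for S
    by (rule locating_dominating_cong) (simp add: ST_edges_eq)
  then show ?thesis by (simp add: locating_domination_number_def ST_verts_eq)
qed

text \<open>For the root, \<open>1 div 2\<close> and \<open>sibling 1\<close> are \<open>0\<close>, which is not a vertex.\<close>

definition sibling :: "nat \<Rightarrow> nat" where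
  "sibling v = (if even v then v + 1 else v - 1)"

lemma in_sibling_edges_iff:
  assumes "1 \<le> u" "1 \<le> v"
  shows "{u, v} \<in> sibling_edges \<longleftrightarrow> u \<in> {v div 2, sibling v, 2 * v, 2 * v + 1}"
proof
  assume "{u, v} \<in> sibling_edges"
  then show "u \<in> {v div 2, sibling v, 2 * v, 2 * v + 1}"
    by (auto simp: sibling_edges_def sibling_def doubleton_eq_iff)
next
  assume "u \<in> {v div 2, sibling v, 2 * v, 2 * v + 1}"
  then consider "u = v div 2" | "even v" "u = v + 1" | "odd v" "u = v - 1"
    | "u = 2 * v" | "u = 2 * v + 1"
    by (auto simp: sibling_def split: if_splits)
  then have "\<exists>x \<ge> 1. {u, v} \<in> {{x, 2 * x}, {x, 2 * x + 1}, {2 * x, 2 * x + 1}}"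
  proof cases
    case 1
    then have "v = 2 * u \<or> v = 2 * u + 1" by linarith
    then show ?thesis using assms(1) by blast
  next
    case 2
    then show ?thesis using assms(2) by (auto elim!: evenE simp: insert_commute)
  next
    case 3
    then show ?thesis using assms(1) by (auto elim!: oddE)
  qed (use assms(2) in \<open>auto simp: insert_commute\<close>)
  then show "{u, v} \<in> sibling_edges" by (auto simp: sibling_edges_def)
qed

lemma sibling_code_eq:
  assumes "0 \<notin> S" "1 \<le> v"
  shows "sibling_code S v = S \<inter> {v div 2, sibling v, 2 * v, 2 * v + 1}"
proof -
  have "u \<in> sibling_code S v \<longleftrightarrow> u \<in> S \<inter> {v div 2, sibling v, 2 * v, 2 * v + 1}" for u
    using in_sibling_edges_iff[of u v] assms
    by (cases "u = 0") (auto simp: neighborhood_def simp del: insert_iff)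
  then show ?thesis by blast
qed

lemma sibling_edge_pos: "{u, v} \<in> sibling_edges \<Longrightarrow> 1 \<le> u \<and> 1 \<le> v"
  by (auto simp: sibling_edges_def doubleton_eq_iff)

lemma common_neighbor_of_larger:
  assumes "{w, u} \<in> sibling_edges" "{w, v} \<in> sibling_edges" "u < v"
  shows "w = v div 2 \<or> w = sibling v"
proof (rule ccontr)
  assume "\<not> ?thesis"
  then have "w = 2 * v \<or> w = 2 * v + 1"
    using assms(2) sibling_edge_pos[OF assms(2)] by (auto simp: in_sibling_edges_iff)
  moreover have "u \<in> {w div 2, sibling w, 2 * w, 2 * w + 1}"
    using assms(1) sibling_edge_pos[OF assms(1)]
    by (simp add: in_sibling_edges_iff insert_commute[of w u])
  ultimately show False using assms(3) by (auto simp: sibling_def)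
qed

lemma two_common_neighbors_imp_eq:
  assumes "{a, u} \<in> sibling_edges" "{b, u} \<in> sibling_edges"
    "{a, v} \<in> sibling_edges" "{b, v} \<in> sibling_edges" "a \<noteq> b"
  shows "u = v"
  using assms
proof (induction u v rule: linorder_wlog)
  case (le u v)
  show ?case
  proof (rule ccontr)
    assume "u \<noteq> v"
    with le have "u < v" by simp
    with le have "{a, b} = {v div 2, sibling v}"
      using common_neighbor_of_larger[of a u v] common_neighbor_of_larger[of b u v] by auto
    with le have edges: "{v div 2, u} \<in> sibling_edges" "{sibling v, u} \<in> sibling_edges"
      by (auto simp: doubleton_eq_iff)
    then have pos: "1 \<le> u" "1 \<le> sibling v" using sibling_edge_pos by blast+
    with \<open>u < v\<close> have family: "sibling v div 2 = v div 2" "sibling (sibling v) = v"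
        "v \<le> 2 * sibling v"
      by (auto simp: sibling_def elim!: oddE)
    have "u \<noteq> v div 2" using edges(1) by (auto simp: sibling_edges_def doubleton_eq_iff)
    then show False
      using edges(2) in_sibling_edges_iff[OF pos] \<open>u < v\<close> family(3)
      by (auto simp: family(1,2) insert_commute[of "sibling v" u])
  qed
qed auto

lemma inj_on_sibling_code:
  assumes inj: "inj_on (sibling_code S) W"
    and two_neighbors: "\<And>v. v \<in> V - W \<Longrightarrow>
      \<exists>a b. a \<noteq> b \<and> {a, b} \<subseteq> sibling_code S v"
  shows "inj_on (sibling_code S) V"
proof (rule inj_onI)
  fix u v
  assume uv: "u \<in> V" "v \<in> V" "sibling_code S u = sibling_code S v"
  show "u = v"
  proof (cases "u \<in> W \<and> v \<in> W")
    case True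
    with inj uv(3) show ?thesis by (auto dest: inj_onD)
  next
    case False
    with uv two_neighbors obtain a b where "a \<noteq> b"
      "{a, b} \<subseteq> sibling_code S u" "{a, b} \<subseteq> sibling_code S v"
      by (metis DiffI)
    then show ?thesis
      by (intro two_common_neighbors_imp_eq[of a u b v]) (auto simp: neighborhood_def)
  qed
qed

section \<open>Adding four levels\<close>

text \<open>
  For \<open>N\<close> a power of two, the new levels are \<open>{N..<2 * N}\<close>, \<open>{2 * N..<4 * N}\<close>, \<open>{4 * N..<8 * N}\<close> and
  \<open>{8 * N..<16 * N}\<close>.
\<close>

definition add_levels :: "nat \<Rightarrow> nat set \<Rightarrow> nat set" where
  "add_levels N S = S \<union> {2 * N..<4 * N} \<union> {v \<in> {8 * N..<16 * N}. even v}"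

context
  fixes N :: nat and S :: "nat set"
  assumes S_subset: "S \<subseteq> {1..<N}"
begin

lemma card_add_levels: "card (add_levels N S) = card S + 6 * N"
proof -
  have evens: "{v \<in> {8 * N..<16 * N}. even v} = (*) 2 ` {4 * N..<8 * N}"
    by (auto elim!: evenE)
  have "card {v \<in> {8 * N..<16 * N}. even v} = 4 * N"
    unfolding evens by (subst card_image) (auto simp: inj_on_def)
  moreover have "S \<inter> {2 * N..<4 * N} = {}"
    "(S \<union> {2 * N..<4 * N}) \<inter> {v \<in> {8 * N..<16 * N}. even v} = {}"
    using S_subset by auto
  moreover have "finite S" using S_subset by (rule finite_subset) simp
  ultimately show ?thesis by (simp add: add_levels_def card_Un_disjoint)
qed

lemma add_levels_subset: "add_levels N S \<subseteq> {1..<16 * N}"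
  using S_subset by (auto simp: add_levels_def)

lemma Diff_add_levels:
  "{1..<16 * N} - add_levels N S =
     ({1..<N} - S) \<union> {v \<in> {8 * N..<16 * N}. odd v} \<union> ({N..<2 * N} \<union> {4 * N..<8 * N})"
  using S_subset by (auto simp: add_levels_def)

lemma sibling_code_add_levels:
  "1 \<le> v \<Longrightarrow> sibling_code (add_levels N S) v =
     add_levels N S \<inter> {v div 2, sibling v, 2 * v, 2 * v + 1}"
  by (rule sibling_code_eq) (use add_levels_subset in auto)

lemma sibling_code_add_levels_old:
  assumes "v \<in> {1..<N}"
  shows "sibling_code (add_levels N S) v = sibling_code S v"
proof -
  have "1 \<le> v" "0 \<notin> S" using assms S_subset by auto
  then show ?thesis
    unfolding sibling_code_add_levels[OF \<open>1 \<le> v\<close>] sibling_code_eq[OF \<open>0 \<notin> S\<close> \<open>1 \<le> v\<close>]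
    using assms by (auto simp: add_levels_def sibling_def)
qed

lemma sibling_code_add_levels_leaf:
  assumes "v \<in> {8 * N..<16 * N}" "odd v"
  shows "sibling_code (add_levels N S) v = {v - 1}"
  using assms S_subset
  by (subst sibling_code_add_levels) (auto simp: add_levels_def sibling_def elim!: oddE)

lemma two_neighbors_in_add_levels:
  assumes "v \<in> {N..<2 * N} \<union> {4 * N..<8 * N}"
  shows "\<exists>a b. a \<noteq> b \<and> {a, b} \<subseteq> sibling_code (add_levels N S) v"
  using assms
proof
  assume "v \<in> {N..<2 * N}"
  then have "{2 * v, 2 * v + 1} \<subseteq> sibling_code (add_levels N S) v"
    by (simp add: sibling_code_add_levels) (simp add: add_levels_def)
  moreover have "2 * v \<noteq> 2 * v + 1" by simp
  ultimately show ?thesis by blast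
next
  assume v: "v \<in> {4 * N..<8 * N}"
  then have "v div 2 \<in> {2 * N..<4 * N}" by auto
  with v have "{v div 2, 2 * v} \<subseteq> sibling_code (add_levels N S) v"
    by (simp add: sibling_code_add_levels) (simp add: add_levels_def)
  moreover have "v div 2 \<noteq> 2 * v" using v by auto
  ultimately show ?thesis by blast
qed

lemma inj_on_sibling_code_add_levels:
  assumes "inj_on (sibling_code S) ({1..<N} - S)"
  shows "inj_on (sibling_code (add_levels N S)) ({1..<16 * N} - add_levels N S)"
proof (rule inj_on_sibling_code)
  let ?code = "sibling_code (add_levels N S)"
  let ?old = "{1..<N} - S" and ?leaves = "{v \<in> {8 * N..<16 * N}. odd v}"
  have "inj_on ?code ?old"
    using assms by (simp add: inj_on_def sibling_code_add_levels_old)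
  moreover have "inj_on ?code ?leaves"
    by (auto simp: inj_on_def sibling_code_add_levels_leaf elim!: oddE)
  moreover have "?code u \<noteq> ?code v" if "u \<in> ?old" "v \<in> ?leaves" for u v
  proof -
    have "?code u = sibling_code S u"
      using that(1) by (simp add: sibling_code_add_levels_old)
    then have "?code u \<subseteq> S" by (auto simp: neighborhood_def)
    moreover have "?code v = {v - 1}" using that(2) by (simp add: sibling_code_add_levels_leaf)
    moreover have "N \<le> v - 1" using that(2) by auto
    ultimately show ?thesis using S_subset by auto
  qed
  ultimately show "inj_on ?code (?old \<union> ?leaves)" by (auto simp: inj_on_Un)
next
  fix v assume "v \<in> {1..<16 * N} - add_levels N S -
      ({1..<N} - S \<union> {v \<in> {8 * N..<16 * N}. odd v})"
  then show "\<exists>a b. a \<noteq> b \<and> {a, b} \<subseteq> sibling_code (add_levels N S) v"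
    unfolding Diff_add_levels by (intro two_neighbors_in_add_levels) blast
qed

lemma sibling_code_add_levels_nonempty:
  assumes "\<forall>v \<in> {1..<N} - S. sibling_code S v \<noteq> {}"
    and "v \<in> {1..<16 * N} - add_levels N S"
  shows "sibling_code (add_levels N S) v \<noteq> {}"
  using assms(2) unfolding Diff_add_levels
proof (elim UnE)
  assume "v \<in> {1..<N} - S"
  with assms(1) show ?thesis by (simp add: sibling_code_add_levels_old)
next
  assume "v \<in> {v \<in> {8 * N..<16 * N}. odd v}"
  then show ?thesis by (simp add: sibling_code_add_levels_leaf)
qed (use two_neighbors_in_add_levels[of v] in blast)+

end

lemma sibling_ld_add_levels:
  assumes "sibling_ld N S"
  shows "sibling_ld (16 * N) (add_levels N S)"
proof -
  have "S \<subseteq> {1..<N}" using assms by (rule locating_dominating_subset)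
  from add_levels_subset[OF this] inj_on_sibling_code_add_levels[OF this]
    sibling_code_add_levels_nonempty[OF this] assms
  show ?thesis unfolding locating_dominating_iff by blast
qed

lemma sibling_ldn_add_levels_le: "sibling_ldn (16 * N) \<le> sibling_ldn N + 6 * N"
proof -
  obtain S where "sibling_ld N S" "card S = sibling_ldn N"
    by (rule locating_domination_number_attained)
  moreover from this have "card (add_levels N S) = card S + 6 * N"
    by (intro card_add_levels locating_dominating_subset)
  ultimately show ?thesis
    using locating_domination_number_le sibling_ld_add_levels by metis
qed

section \<open>Removing four levels\<close>

lemma card_Int_atLeastLessThan_split:
  fixes a b c :: nat
  assumes "a \<le> b" "b \<le> c"
  shows "card (S \<inter> {a..<b}) + card (S \<inter> {b..<c}) = card (S \<inter> {a..<c})"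
proof -
  have "S \<inter> {a..<c} = S \<inter> {a..<b} \<union> S \<inter> {b..<c}" using assms by auto
  then show ?thesis by (simp only:) (auto intro: card_Un_disjoint[symmetric])
qed

definition height2_subtree :: "nat \<Rightarrow> nat set" where
  "height2_subtree w = {w, 2 * w, 2 * w + 1, 4 * w, 4 * w + 1, 4 * w + 2, 4 * w + 3}"

context
  fixes N :: nat and S :: "nat set"
  assumes ld: "sibling_ld N S"
begin

lemma sibling_code_ld:
  "1 \<le> v \<Longrightarrow> sibling_code S v = S \<inter> {v div 2, sibling v, 2 * v, 2 * v + 1}"
  using locating_dominating_subset[OF ld] by (intro sibling_code_eq) auto

lemma sibling_code_inj:
  "\<lbrakk>sibling_code S u = sibling_code S v; u \<in> {1..<N} - S; v \<in> {1..<N} - S\<rbrakk> \<Longrightarrow> u = v"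
  using ld by (auto simp: locating_dominating_iff inj_on_def)

lemma not_member_if_ge: "N \<le> v \<Longrightarrow> v \<notin> S"
  using ld by (auto simp: locating_dominating_iff)

lemma leaf_pair_has_member:
  assumes "1 \<le> x" "2 * x + 1 < N" "N \<le> 4 * x"
  shows "2 * x \<in> S \<or> 2 * x + 1 \<in> S"
proof (rule ccontr)
  assume neither: "\<not> ?thesis"
  then have "sibling_code S (2 * x) = sibling_code S (2 * x + 1)"
    using assms by (auto simp: sibling_code_ld sibling_def not_member_if_ge)
  with neither assms sibling_code_inj[of "2 * x" "2 * x + 1"] show False by auto
qed

lemma member_near_parent_of_split_leaf_pair:
  assumes "1 \<le> x" "2 * x + 1 < N" "N \<le> 4 * x" "(2 * x \<in> S) \<noteq> (2 * x + 1 \<in> S)"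
  shows "x \<in> S \<or> x div 2 \<in> S \<or> sibling x \<in> S"
proof (rule ccontr)
  assume none: "\<not> ?thesis"
  obtain l where l: "{l, sibling l} = {2 * x, 2 * x + 1}" "l \<in> S" "sibling l \<notin> S"
    using assms(4) that[of "2 * x"] that[of "2 * x + 1"]
    by (cases "2 * x \<in> S") (auto simp: sibling_def)
  with assms none have "sibling_code S (sibling l) = {l}"
    by (auto simp: sibling_code_ld not_member_if_ge doubleton_eq_iff sibling_def)
  moreover have "sibling_code S x = {l}"
    using l assms none by (auto simp: sibling_code_ld doubleton_eq_iff)
  moreover have "{x, sibling l} \<subseteq> {1..<N} - S" "x \<noteq> sibling l"
    using l assms none by (auto simp: doubleton_eq_iff)
  ultimately show False using sibling_code_inj[of x "sibling l"] by blast
qed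

lemma card_Int_height2_subtree_ge:
  assumes "1 \<le> w" "4 * w + 3 < N" "N \<le> 8 * w"
  shows "3 \<le> card (S \<inter> height2_subtree w)"
proof -
  have "4 * w \<in> S \<or> 4 * w + 1 \<in> S" "4 * w + 2 \<in> S \<or> 4 * w + 3 \<in> S"
    using leaf_pair_has_member[of "2 * w"] leaf_pair_has_member[of "2 * w + 1"] assms
    by (auto simp: numeral_3_eq_3)
  moreover have "2 * w \<in> S \<or> w \<in> S \<or> 2 * w + 1 \<in> S" if "(4 * w \<in> S) \<noteq> (4 * w + 1 \<in> S)"
    using member_near_parent_of_split_leaf_pair[of "2 * w"] that assms by (auto simp: sibling_def)
  ultimately show ?thesis
    using assms(1)
    by (auto simp: height2_subtree_def Int_insert_right card_insert_if numeral_3_eq_3)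
qed

end

lemma card_Int_last_three_levels_ge:
  assumes "sibling_ld (16 * N) S"
  shows "6 * N \<le> card (S \<inter> {2 * N..<16 * N})"
proof -
  have "6 * N = (\<Sum>w = 2 * N..<4 * N. 3)" by simp
  also have "\<dots> \<le> (\<Sum>w = 2 * N..<4 * N. card (S \<inter> height2_subtree w))"
    by (intro sum_mono card_Int_height2_subtree_ge[OF assms]) auto
  also have "\<dots> = card (\<Union>w \<in> {2 * N..<4 * N}. S \<inter> height2_subtree w)"
  proof (rule card_UN_disjoint[symmetric])
    have "w = (if z < 4 * N then z else if z < 8 * N then z div 2 else z div 4)"
      if "w \<in> {2 * N..<4 * N}" "z \<in> height2_subtree w" for w z
      using that by (auto simp: height2_subtree_def)
    then show "\<forall>v \<in> {2 * N..<4 * N}. \<forall>w \<in> {2 * N..<4 * N}. v \<noteq> w \<longrightarrow>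
        (S \<inter> height2_subtree v) \<inter> (S \<inter> height2_subtree w) = {}"
      by blast
  qed (auto simp: height2_subtree_def)
  also have "\<dots> \<le> card (S \<inter> {2 * N..<16 * N})"
    by (intro card_mono) (auto simp: height2_subtree_def)
  finally show ?thesis .
qed

text \<open>The root has the junk parent \<open>1 div 2 = 0\<close>, which matters for \<open>N = 1\<close>.\<close>

definition move_to_parents :: "nat \<Rightarrow> nat set \<Rightarrow> nat set" where
  "move_to_parents N S = S \<inter> {1..<N} \<union> ((\<lambda>c. c div 2) ` (S \<inter> {N..<2 * N}) - {0})"

text \<open>For odd \<open>N > 1\<close>, the siblings \<open>N - 1\<close> and \<open>N\<close> would lie on different sides of the cut.\<close>

lemma sibling_ld_move_to_parents:
  assumes "sibling_ld (16 * N) S" "even N \<or> N = 1"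
  shows "sibling_ld N (move_to_parents N S)"
proof -
  have S_subset: "S \<subseteq> {1..<16 * N}" using assms(1) by (rule locating_dominating_subset)
  have move_subset: "move_to_parents N S \<subseteq> {1..<N}" by (auto simp: move_to_parents_def)
  let ?T = "S \<union> move_to_parents N S"
  have "sibling_ld (16 * N) ?T"
    using assms(1)
    by (rule locating_dominating_superset) (use S_subset move_subset in \<open>auto simp: subset_iff\<close>)
  then have "sibling_ld N (?T \<inter> {1..<N})"
  proof (rule locating_dominating_restrict)
    fix u v assume u: "u \<in> ?T - {1..<N}" and v: "v \<in> {1..<N} - ?T"
    show "{u, v} \<notin> sibling_edges"
    proof
      assume "{u, v} \<in> sibling_edges"
      then have "u \<in> {v div 2, sibling v, 2 * v, 2 * v + 1}"
        using u v S_subset move_subset by (subst (asm) in_sibling_edges_iff) auto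
      moreover have "u \<in> S" "N \<le> u" using u S_subset move_subset by auto
      moreover have "sibling v < N" using v assms(2) by (auto simp: sibling_def elim!: evenE)
      ultimately have "u \<in> S \<inter> {N..<2 * N}" "u div 2 = v" using v by auto
      then have "v \<in> move_to_parents N S" using v by (force simp: move_to_parents_def)
      with v show False by simp
    qed
  qed auto
  moreover have "?T \<inter> {1..<N} = move_to_parents N S"
    using move_subset by (auto simp: move_to_parents_def)
  ultimately show ?thesis by simp
qed

lemma card_move_to_parents_le:
  assumes "1 \<le> N"
  shows "card (move_to_parents N S) \<le> card (S \<inter> {1..<2 * N})"
proof -
  let ?level = "S \<inter> {N..<2 * N}" and ?parent = "\<lambda>c :: nat. c div 2"
  have "card (?parent ` ?level - {0}) \<le> card (?parent ` ?level)"
    by (intro card_mono) auto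
  also have "\<dots> \<le> card ?level" by (rule card_image_le) simp
  finally have "card (move_to_parents N S) \<le> card (S \<inter> {1..<N}) + card ?level"
    unfolding move_to_parents_def by (intro order_trans[OF card_Un_le] add_left_mono)
  also have "\<dots> = card (S \<inter> {1..<2 * N})"
    using assms by (intro card_Int_atLeastLessThan_split) auto
  finally show ?thesis .
qed

lemma sibling_ldn_add_levels_ge:
  assumes "1 \<le> N" "even N \<or> N = 1"
  shows "sibling_ldn N + 6 * N \<le> sibling_ldn (16 * N)"
proof -
  obtain S where S: "sibling_ld (16 * N) S" "card S = sibling_ldn (16 * N)"
    by (rule locating_domination_number_attained)
  have "sibling_ldn N \<le> card (move_to_parents N S)"
    using sibling_ld_move_to_parents[OF S(1) assms(2)] by (rule locating_domination_number_le)
  also have "\<dots> \<le> card (S \<inter> {1..<2 * N})" using assms(1) by (rule card_move_to_parents_le)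
  finally have "sibling_ldn N + 6 * N \<le> card (S \<inter> {1..<2 * N}) + card (S \<inter> {2 * N..<16 * N})"
    using card_Int_last_three_levels_ge[OF S(1)] by simp
  also have "\<dots> = card (S \<inter> {1..<16 * N})"
    using assms(1) by (intro card_Int_atLeastLessThan_split) auto
  also have "S \<inter> {1..<16 * N} = S"
    using locating_dominating_subset[OF S(1)] by blast
  finally show ?thesis using S(2) by simp
qed

section \<open>The locating-domination number\<close>

lemma sibling_ldn_small_le:
  assumes "m \<le> 3"
  shows "sibling_ldn (2 ^ m) \<le> m"
proof -
  have "sibling_ldn 1 \<le> card ({} :: nat set)"
    by (rule locating_domination_number_le) (simp add: locating_dominating_iff)
  moreover have "sibling_ldn 2 \<le> card {1::nat}"
    by (rule locating_domination_number_le) (auto simp: locating_dominating_iff inj_on_def)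
  moreover have "sibling_ldn 4 \<le> card {1, 2::nat}"
  proof (rule locating_domination_number_le)
    have "sibling_code {1, 2} 3 = {1, 2}"
      by (subst sibling_code_eq) (auto simp: sibling_def)
    moreover have "{1..<4} - {1, 2} = {3::nat}" by auto
    ultimately show "sibling_ld 4 {1, 2}" by (auto simp: locating_dominating_iff)
  qed
  moreover have "sibling_ldn 8 \<le> card {1, 4, 6::nat}"
  proof (rule locating_domination_number_le)
    have "sibling_code {1, 4, 6} 2 = {1, 4}" "sibling_code {1, 4, 6} 3 = {1, 6}"
      "sibling_code {1, 4, 6} 5 = {4}" "sibling_code {1, 4, 6} 7 = {6}"
      by (auto simp: sibling_code_eq sibling_def)
    moreover have "{1..<8} - {1, 4, 6} = {2, 3, 5, 7::nat}" by auto
    ultimately show "sibling_ld 8 {1, 4, 6}"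
      by (auto simp: locating_dominating_iff doubleton_eq_iff)
  qed
  moreover have "m = 0 \<or> m = 1 \<or> m = 2 \<or> m = 3" using assms by linarith
  ultimately show ?thesis by auto
qed

lemma sibling_ldn_small_ge:
  assumes "m \<le> 3"
  shows "m \<le> sibling_ldn (2 ^ m)"
proof -
  obtain S where S: "sibling_ld (2 ^ m) S" "card S = sibling_ldn (2 ^ m)"
    by (rule locating_domination_number_attained)
  have "S \<subseteq> {1..<2 ^ m}" using S(1) by (rule locating_dominating_subset)
  then have "finite S" "card ({1..<2 ^ m} - S) = 2 ^ m - 1 - card S"
    by (auto simp: card_Diff_subset finite_subset)
  then have "2 ^ m - 1 - card S < 2 ^ card S"
    using card_Diff_locating_dominating[OF S(1)] by simp
  moreover have "m = 0 \<or> m = 1 \<or> m = 2 \<or> m = 3" using assms by linarith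
  moreover have "card S = 0 \<or> card S = 1 \<or> card S = 2 \<or> card S \<ge> 3" by linarith
  ultimately show ?thesis unfolding S(2) by auto
qed

lemma sibling_ldn_add_levels: "sibling_ldn (2 ^ (m + 4)) = sibling_ldn (2 ^ m) + 6 * 2 ^ m"
proof -
  have "sibling_ldn (16 * 2 ^ m) = sibling_ldn (2 ^ m) + 6 * 2 ^ m"
    by (intro antisym sibling_ldn_add_levels_le sibling_ldn_add_levels_ge) auto
  then show ?thesis by (simp add: power_add mult.commute)
qed

lemma sibling_ldn_power_of_two:
  "5 * real (sibling_ldn (2 ^ m)) = 2 ^ (m + 1) + [- 2, 1, 2, - 1] ! (m mod 4)"
proof (induction m rule: less_induct)
  case (less m)
  show ?case
  proof (cases "m \<le> 3")
    case True
    then have "sibling_ldn (2 ^ m) = m"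
      using sibling_ldn_small_le sibling_ldn_small_ge by (intro antisym)
    moreover have "m = 0 \<or> m = 1 \<or> m = 2 \<or> m = 3" using True by linarith
    ultimately show ?thesis by auto
  next
    case False
    then obtain k where m: "m = k + 4" using that[of "m - 4"] by simp
    then have "k < m" by simp
    from less[OF this] show ?thesis
      unfolding m sibling_ldn_add_levels by (simp add: power_add)
  qed
qed

theorem theorem7:
  fixes n :: nat
  assumes "n \<ge> 1"
  shows "real (locating_domination_number (ST_verts n) (ST_edges n)) =
    (if n mod 4 = 0 then (2 ^ (n + 2) + 1) / 5
     else if n mod 4 = 1 then (2 ^ (n + 2) + 2) / 5
     else if n mod 4 = 2 then (2 ^ (n + 2) - 1) / 5
     else (2 ^ (n + 2) - 2) / 5)"
proof -
  have "n mod 4 < 4" by simp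
  then consider "n mod 4 = 0" | "n mod 4 = 1" | "n mod 4 = 2" | "n mod 4 = 3" by linarith
  then show ?thesis
    using sibling_ldn_power_of_two[of "n + 1"]
    by cases (simp_all add: locating_domination_number_ST mod_Suc)
qed

end
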